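(* Let $0\le t<T$, let $m>n$, let $A,K:[0,T]\to\mathbb{R}^{n\times n}$ and $L:[0,T]\to\mathbb{R}^{n\times(m-n)}$ be bounded measurable functions, let $G\in\mathbb{R}^{n\times n}$ be symmetric, and let $Q,R:[0,T]\to\mathbb{R}^{n\times n}$ and $N:[0,T]\to\mathbb{R}^{(m-n)\times(m-n)}$ be bounded, measurable and symmetric-matrix-valued, such that for some $\delta>0$: $G\ge0$, $Q(s)\ge0$, $R(s)\ge0$, $N(s)\ge\delta I_{m-n}$ for a.e. $s\in[0,T]$. Let $F\in\mathbb{R}^{k\times n}$ ($k\le n$), $b\in L^2_{\mathcal{F}_t}(\Omega;\mathbb{R}^k)$, $\lambda\in L^2_{\mathcal{F}_t}(\Omega;\mathbb{R}^k)$ and let $\eta\in L^2_{\mathcal{F}_T}(\Omega;\mathbb{R}^n)$ be given. If $v^*_\lambda$ is an optimal control of Problem (BLQ)$_\lambda$ such that the adapted solution $(x^*_\lambda,z^*_\lambda)$ of $$\left\{\begin{aligned}dx^*_\lambda(s)&=[A(s)x^*_\lambda(s)+K(s)z^*_\lambda(s)+L(s)v^*_\lambda(s)]ds+z^*_\lambda(s)dW(s),\quad s\in[t,T],\\ x^*_\lambda(T)&=\eta,\end{aligned}\right.$$ satisfies $x^*_\lambda(t)\in\mathcal{H}(F,b)$, then $v^*_\lambda$ is also optimal for Problem (CBLQ).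
   Context: $(\Omega,\mathcal{F},\mathbb{P})$ is a complete probability space carrying a standard one-dimensional Brownian motion $W$, and $\mathbb{F}=\{\mathcal{F}_s\}_{s\ge0}$ is the natural filtration of $W$ augmented by all $\mathbb{P}$-null sets. $L^2_{\mathcal{F}_s}(\Omega;\mathbb{R}^d)$ is the space of $\mathcal{F}_s$-measurable square-integrable $\mathbb{R}^d$-valued random variables; $L^2_{\mathbb F}(t,T;\mathbb{R}^d)$ is the space of $\mathbb{F}$-progressively measurable $u:[t,T]\times\Omega\to\mathbb{R}^d$ with $\mathbb{E}\int_t^T|u(s)|^2ds<\infty$; $L^2_{\mathbb F}(\Omega;C([t,T];\mathbb{R}^d))$ is the space of $\mathbb{F}$-adapted continuous processes $x$ with $\mathbb{E}[\sup_{t\le s\le T}|x(s)|^2]<\infty$. An adapted solution $(x,z)$ of a BSDE on $[t,T]$ is understood in $L^2_{\mathbb F}(\Omega;C([t,T];\mathbb{R}^n))\times L^2_{\mathbb F}(t,T;\mathbb{R}^n)$. $\mathcal{H}(F,b)=\{\xi\in L^2_{\mathcal{F}_t}(\Omega;\mathbb{R}^n):F\xi=b\}$. Backward state equation: for $v\in L^2_{\mathbb F}(t,T;\mathbb{R}^{m-n})$, $(x,z)$ is the adapted solution of $$dx(s)=[A(s)x(s)+K(s)z(s)+L(s)v(s)]ds+z(s)dW(s),\ s\in[t,T],\qquad x(T)=\eta. \quad(\mathrm{B})$$ Cost functional: $J(t,v)=\mathbb{E}\{\langle Gx(t),x(t)\rangle+\int_t^T[\langle Qx,x\rangle+\langle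 Rz,z\rangle+\langle Nv,v\rangle]ds\}$. Problem (CBLQ): find $v^*\in L^2_{\mathbb F}(t,T;\mathbb{R}^{m-n})$ such that the corresponding adapted solution $(x^*,z^* )$ of (B) satisfies $x^*(t)\in\mathcal{H}(F,b)$ and $J(t,v^* )\le J(t,v)$ for all $v\in L^2_{\mathbb F}(t,T;\mathbb{R}^{m-n})$ for which the corresponding solution of (B) satisfies $x(t)\in\mathcal{H}(F,b)$; such $v^*$ is called optimal. Problem (BLQ)$_\lambda$: find $v^*\in L^2_{\mathbb F}(t,T;\mathbb{R}^{m-n})$ (an optimal control) such that $J_\lambda(t,v^* )\le J_\lambda(t,v)$ for all $v\in L^2_{\mathbb F}(t,T;\mathbb{R}^{m-n})$, subject to (B), where $J_\lambda(t,v)=J(t,v)+2\mathbb{E}\langle F^\top\lambda,x(t)\rangle$. *)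

theory Defs
  imports "HOL-Probability.Probability"
begin

text \<open>
  Processes are functions \<open>real \<Rightarrow> 'a \<Rightarrow> _\<close> (time first, then scenario). Only their values at
  times in the interval under consideration are ever consulted.
\<close>

section \<open>Brownian motion and its augmented filtration\<close>

definition standard_brownian_motion :: "'a measure \<Rightarrow> (real \<Rightarrow> 'a \<Rightarrow> real) \<Rightarrow> bool" where
  "standard_brownian_motion M W \<longleftrightarrow>
     (\<forall>s\<ge>0. W s \<in> borel_measurable M) \<and>
     (AE \<omega> in M. W 0 \<omega> = 0) \<and>
     (\<forall>(p::nat) \<tau>. 0 \<le> \<tau> 0 \<and> (\<forall>i<p. \<tau> i < \<tau> (Suc i)) \<longrightarrow>
        prob_space.indep_vars M (\<lambda>_. borel) (\<lambda>i \<omega>. W (\<tau> (Suc i)) \<omega> - W (\<tau> i) \<omega>) {..<p}) \<and>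
     (\<forall>r s. 0 \<le> r \<and> r < s \<longrightarrow>
        distributed M lborel (\<lambda>\<omega>. W s \<omega> - W r \<omega>) (\<lambda>x. ennreal (normal_density 0 (sqrt (s - r)) x))) \<and>
     (AE \<omega> in M. continuous_on {0..} (\<lambda>s. W s \<omega>))"

text \<open>
  Only the space and the sets of this measure are meaningful: it stands for the sigma-algebra
  generated by the variables \<open>W r\<close>, \<open>0 \<le> r \<le> s\<close>, and by all null sets.
\<close>

definition aug_filtration :: "'a measure \<Rightarrow> (real \<Rightarrow> 'a \<Rightarrow> real) \<Rightarrow> real \<Rightarrow> 'a measure" where
  "aug_filtration M W s =
     sigma (space M) ({W r -` B \<inter> space M | r B. 0 \<le> r \<and> r \<le> s \<and> B \<in> sets borel} \<union> null_sets M)"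

section \<open>Spaces of random variables and processes\<close>

definition L2_rv :: "'a measure \<Rightarrow> (real \<Rightarrow> 'a \<Rightarrow> real) \<Rightarrow> real \<Rightarrow> ('a \<Rightarrow> real ^ 'd) set" where
  "L2_rv M W s =
     {\<xi>. \<xi> \<in> borel_measurable (aug_filtration M W s) \<and> integrable M (\<lambda>\<omega>. (norm (\<xi> \<omega>))\<^sup>2)}"

definition prog_measurable ::
    "'a measure \<Rightarrow> (real \<Rightarrow> 'a \<Rightarrow> real) \<Rightarrow> real \<Rightarrow> real \<Rightarrow> (real \<Rightarrow> 'a \<Rightarrow> real ^ 'd) \<Rightarrow> bool" where
  "prog_measurable M W t T u \<longleftrightarrow>
     (\<forall>s\<in>{t..T}. (\<lambda>(r, \<omega>). u r \<omega>)
        \<in> borel_measurable (restrict_space borel {t..s} \<Otimes>\<^sub>M aug_filtration M W s))"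

definition L2_prog ::
    "'a measure \<Rightarrow> (real \<Rightarrow> 'a \<Rightarrow> real) \<Rightarrow> real \<Rightarrow> real \<Rightarrow> (real \<Rightarrow> 'a \<Rightarrow> real ^ 'd) set" where
  "L2_prog M W t T =
     {u. prog_measurable M W t T u \<and>
         (\<integral>\<^sup>+\<omega>. (\<integral>\<^sup>+s. ennreal ((norm (u s \<omega>))\<^sup>2) \<partial>lebesgue_on {t..T}) \<partial>M) < \<infinity>}"

definition L2_cont ::
    "'a measure \<Rightarrow> (real \<Rightarrow> 'a \<Rightarrow> real) \<Rightarrow> real \<Rightarrow> real \<Rightarrow> (real \<Rightarrow> 'a \<Rightarrow> real ^ 'd) set" where
  "L2_cont M W t T =
     {x. (\<forall>s\<in>{t..T}. x s \<in> borel_measurable (aug_filtration M W s)) \<and>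
         (\<forall>\<omega>\<in>space M. continuous_on {t..T} (\<lambda>s. x s \<omega>)) \<and>
         (\<integral>\<^sup>+\<omega>. (SUP s\<in>{t..T}. ennreal ((norm (x s \<omega>))\<^sup>2)) \<partial>M) < \<infinity>}"

section \<open>The Ito integral\<close>

text \<open>
  An elementary process on \<open>[t, s]\<close> is given by a partition \<open>t = \<tau> 0 < \<dots> < \<tau> p = s\<close> and bounded
  random variables \<open>\<xi> i\<close>, measurable at time \<open>\<tau> i\<close>. The case \<open>p = 0\<close> is possible only for \<open>s = t\<close>.
\<close>

definition elementary_data ::
    "'a measure \<Rightarrow> (real \<Rightarrow> 'a \<Rightarrow> real) \<Rightarrow> real \<Rightarrow> real \<Rightarrow>
     nat \<Rightarrow> (nat \<Rightarrow> real) \<Rightarrow> (nat \<Rightarrow> 'a \<Rightarrow> real ^ 'd) \<Rightarrow> bool" where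
  "elementary_data M W t s p \<tau> \<xi> \<longleftrightarrow>
     \<tau> 0 = t \<and> \<tau> p = s \<and> (\<forall>i<p. \<tau> i < \<tau> (Suc i)) \<and>
     (\<forall>i<p. \<xi> i \<in> borel_measurable (aug_filtration M W (\<tau> i)) \<and>
            (\<exists>C. \<forall>\<omega>\<in>space M. norm (\<xi> i \<omega>) \<le> C))"

definition elementary_process ::
    "nat \<Rightarrow> (nat \<Rightarrow> real) \<Rightarrow> (nat \<Rightarrow> 'a \<Rightarrow> real ^ 'd) \<Rightarrow> real \<Rightarrow> 'a \<Rightarrow> real ^ 'd" where
  "elementary_process p \<tau> \<xi> r \<omega> = (\<Sum>i<p. indicator {\<tau> i<..\<tau> (Suc i)} r *\<^sub>R \<xi> i \<omega>)"

definition elementary_integral ::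
    "(real \<Rightarrow> 'a \<Rightarrow> real) \<Rightarrow> nat \<Rightarrow> (nat \<Rightarrow> real) \<Rightarrow> (nat \<Rightarrow> 'a \<Rightarrow> real ^ 'd) \<Rightarrow> 'a \<Rightarrow> real ^ 'd" where
  "elementary_integral W p \<tau> \<xi> \<omega> = (\<Sum>i<p. (W (\<tau> (Suc i)) \<omega> - W (\<tau> i) \<omega>) *\<^sub>R \<xi> i \<omega>)"

text \<open>
  \<open>Y\<close> is a version of \<open>\<integral>\<^sub>t\<^sup>s z dW\<close>: the mean-square limit of the integrals of elementary processes
  that approximate \<open>z\<close> in mean square. By the Ito isometry \<open>Y\<close> is unique up to null sets.
\<close>

definition has_ito_integral ::
    "'a measure \<Rightarrow> (real \<Rightarrow> 'a \<Rightarrow> real) \<Rightarrow> real \<Rightarrow> real \<Rightarrow>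
     (real \<Rightarrow> 'a \<Rightarrow> real ^ 'd) \<Rightarrow> ('a \<Rightarrow> real ^ 'd) \<Rightarrow> bool" where
  "has_ito_integral M W t s z Y \<longleftrightarrow>
     Y \<in> borel_measurable M \<and>
     (\<exists>p \<tau> \<xi>.
        (\<forall>j::nat. elementary_data M W t s (p j) (\<tau> j) (\<xi> j)) \<and>
        (\<lambda>j. \<integral>\<^sup>+\<omega>. (\<integral>\<^sup>+r. ennreal ((norm (z r \<omega> - elementary_process (p j) (\<tau> j) (\<xi> j) r \<omega>))\<^sup>2)
               \<partial>lebesgue_on {t..s}) \<partial>M) \<longlonglongrightarrow> 0 \<and>
        (\<lambda>j. \<integral>\<^sup>+\<omega>. ennreal ((norm (Y \<omega> - elementary_integral W (p j) (\<tau> j) (\<xi> j) \<omega>))\<^sup>2) \<partial>M)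
          \<longlonglongrightarrow> 0)"

section \<open>The backward state equation\<close>

definition is_adapted_solution ::
    "'a measure \<Rightarrow> (real \<Rightarrow> 'a \<Rightarrow> real) \<Rightarrow> real \<Rightarrow> real \<Rightarrow>
     (real \<Rightarrow> real ^ 'n ^ 'n) \<Rightarrow> (real \<Rightarrow> real ^ 'n ^ 'n) \<Rightarrow> (real \<Rightarrow> real ^ 'l ^ 'n) \<Rightarrow>
     ('a \<Rightarrow> real ^ 'n) \<Rightarrow> (real \<Rightarrow> 'a \<Rightarrow> real ^ 'l) \<Rightarrow>
     (real \<Rightarrow> 'a \<Rightarrow> real ^ 'n) \<Rightarrow> (real \<Rightarrow> 'a \<Rightarrow> real ^ 'n) \<Rightarrow> bool" where
  "is_adapted_solution M W t T A K L \<eta> v x z \<longleftrightarrow>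
     x \<in> L2_cont M W t T \<and> z \<in> L2_prog M W t T \<and>
     (\<forall>s\<in>{t..T}. \<exists>Y. has_ito_integral M W t s z Y \<and>
        (AE \<omega> in M. x s \<omega> =
           x t \<omega> + (LINT r|lebesgue_on {t..s}. A r *v x r \<omega> + K r *v z r \<omega> + L r *v v r \<omega>) + Y \<omega>)) \<and>
     (AE \<omega> in M. x T \<omega> = \<eta> \<omega>)"

text \<open>
  The adapted solution \<open>(x, z)\<close> belonging to the control \<open>v\<close>. It is unique only up to
  indistinguishability of \<open>x\<close> and almost-everywhere equality of \<open>z\<close>, so a representative is
  chosen; the costs and constraints below do not depend on this choice.
\<close>

definition adapted_solution ::
    "'a measure \<Rightarrow> (real \<Rightarrow> 'a \<Rightarrow> real) \<Rightarrow> real \<Rightarrow> real \<Rightarrow>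
     (real \<Rightarrow> real ^ 'n ^ 'n) \<Rightarrow> (real \<Rightarrow> real ^ 'n ^ 'n) \<Rightarrow> (real \<Rightarrow> real ^ 'l ^ 'n) \<Rightarrow>
     ('a \<Rightarrow> real ^ 'n) \<Rightarrow> (real \<Rightarrow> 'a \<Rightarrow> real ^ 'l) \<Rightarrow>
     (real \<Rightarrow> 'a \<Rightarrow> real ^ 'n) \<times> (real \<Rightarrow> 'a \<Rightarrow> real ^ 'n)" where
  "adapted_solution M W t T A K L \<eta> v =
     (SOME (x, z). is_adapted_solution M W t T A K L \<eta> v x z)"

section \<open>The linear-quadratic control problems\<close>

definition sym_psd :: "real ^ 'd ^ 'd \<Rightarrow> bool" where
  "sym_psd S \<longleftrightarrow> transpose S = S \<and> (\<forall>y. 0 \<le> (S *v y) \<bullet> y)"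

definition constraint_set ::
    "'a measure \<Rightarrow> (real \<Rightarrow> 'a \<Rightarrow> real) \<Rightarrow> real \<Rightarrow> real ^ 'n ^ 'k \<Rightarrow> ('a \<Rightarrow> real ^ 'k) \<Rightarrow>
     ('a \<Rightarrow> real ^ 'n) set" where
  "constraint_set M W t F b = {\<xi> \<in> L2_rv M W t. AE \<omega> in M. F *v \<xi> \<omega> = b \<omega>}"

definition cost_J ::
    "'a measure \<Rightarrow> (real \<Rightarrow> 'a \<Rightarrow> real) \<Rightarrow> real \<Rightarrow> real \<Rightarrow>
     (real \<Rightarrow> real ^ 'n ^ 'n) \<Rightarrow> (real \<Rightarrow> real ^ 'n ^ 'n) \<Rightarrow> (real \<Rightarrow> real ^ 'l ^ 'n) \<Rightarrow>
     ('a \<Rightarrow> real ^ 'n) \<Rightarrow>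
     real ^ 'n ^ 'n \<Rightarrow> (real \<Rightarrow> real ^ 'n ^ 'n) \<Rightarrow> (real \<Rightarrow> real ^ 'n ^ 'n) \<Rightarrow> (real \<Rightarrow> real ^ 'l ^ 'l) \<Rightarrow>
     (real \<Rightarrow> 'a \<Rightarrow> real ^ 'l) \<Rightarrow> real" where
  "cost_J M W t T A K L \<eta> G Q R N v =
     (let (x, z) = adapted_solution M W t T A K L \<eta> v in
      LINT \<omega>|M. (G *v x t \<omega>) \<bullet> x t \<omega> +
        (LINT s|lebesgue_on {t..T}.
           (Q s *v x s \<omega>) \<bullet> x s \<omega> + (R s *v z s \<omega>) \<bullet> z s \<omega> + (N s *v v s \<omega>) \<bullet> v s \<omega>))"

definition cost_J_lam ::
    "'a measure \<Rightarrow> (real \<Rightarrow> 'a \<Rightarrow> real) \<Rightarrow> real \<Rightarrow> real \<Rightarrow>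
     (real \<Rightarrow> real ^ 'n ^ 'n) \<Rightarrow> (real \<Rightarrow> real ^ 'n ^ 'n) \<Rightarrow> (real \<Rightarrow> real ^ 'l ^ 'n) \<Rightarrow>
     ('a \<Rightarrow> real ^ 'n) \<Rightarrow>
     real ^ 'n ^ 'n \<Rightarrow> (real \<Rightarrow> real ^ 'n ^ 'n) \<Rightarrow> (real \<Rightarrow> real ^ 'n ^ 'n) \<Rightarrow> (real \<Rightarrow> real ^ 'l ^ 'l) \<Rightarrow>
     real ^ 'n ^ 'k \<Rightarrow> ('a \<Rightarrow> real ^ 'k) \<Rightarrow> (real \<Rightarrow> 'a \<Rightarrow> real ^ 'l) \<Rightarrow> real" where
  "cost_J_lam M W t T A K L \<eta> G Q R N F lam v =
     cost_J M W t T A K L \<eta> G Q R N v +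
     (let (x, z) = adapted_solution M W t T A K L \<eta> v in
      2 * (LINT \<omega>|M. (transpose F *v lam \<omega>) \<bullet> x t \<omega>))"

definition optimal_BLQ ::
    "'a measure \<Rightarrow> (real \<Rightarrow> 'a \<Rightarrow> real) \<Rightarrow> real \<Rightarrow> real \<Rightarrow>
     (real \<Rightarrow> real ^ 'n ^ 'n) \<Rightarrow> (real \<Rightarrow> real ^ 'n ^ 'n) \<Rightarrow> (real \<Rightarrow> real ^ 'l ^ 'n) \<Rightarrow>
     ('a \<Rightarrow> real ^ 'n) \<Rightarrow>
     real ^ 'n ^ 'n \<Rightarrow> (real \<Rightarrow> real ^ 'n ^ 'n) \<Rightarrow> (real \<Rightarrow> real ^ 'n ^ 'n) \<Rightarrow> (real \<Rightarrow> real ^ 'l ^ 'l) \<Rightarrow>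
     real ^ 'n ^ 'k \<Rightarrow> ('a \<Rightarrow> real ^ 'k) \<Rightarrow> (real \<Rightarrow> 'a \<Rightarrow> real ^ 'l) \<Rightarrow> bool" where
  "optimal_BLQ M W t T A K L \<eta> G Q R N F lam vs \<longleftrightarrow>
     vs \<in> L2_prog M W t T \<and>
     (\<forall>v \<in> L2_prog M W t T.
        cost_J_lam M W t T A K L \<eta> G Q R N F lam vs \<le> cost_J_lam M W t T A K L \<eta> G Q R N F lam v)"

definition optimal_CBLQ ::
    "'a measure \<Rightarrow> (real \<Rightarrow> 'a \<Rightarrow> real) \<Rightarrow> real \<Rightarrow> real \<Rightarrow>
     (real \<Rightarrow> real ^ 'n ^ 'n) \<Rightarrow> (real \<Rightarrow> real ^ 'n ^ 'n) \<Rightarrow> (real \<Rightarrow> real ^ 'l ^ 'n) \<Rightarrow>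
     ('a \<Rightarrow> real ^ 'n) \<Rightarrow>
     real ^ 'n ^ 'n \<Rightarrow> (real \<Rightarrow> real ^ 'n ^ 'n) \<Rightarrow> (real \<Rightarrow> real ^ 'n ^ 'n) \<Rightarrow> (real \<Rightarrow> real ^ 'l ^ 'l) \<Rightarrow>
     real ^ 'n ^ 'k \<Rightarrow> ('a \<Rightarrow> real ^ 'k) \<Rightarrow> (real \<Rightarrow> 'a \<Rightarrow> real ^ 'l) \<Rightarrow> bool" where
  "optimal_CBLQ M W t T A K L \<eta> G Q R N F b vs \<longleftrightarrow>
     vs \<in> L2_prog M W t T \<and>
     fst (adapted_solution M W t T A K L \<eta> vs) t \<in> constraint_set M W t F b \<and>
     (\<forall>v \<in> L2_prog M W t T.
        fst (adapted_solution M W t T A K L \<eta> v) t \<in> constraint_set M W t F b \<longrightarrow>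
        cost_J M W t T A K L \<eta> G Q R N vs \<le> cost_J M W t T A K L \<eta> G Q R N v)"

end

theory Submission
  imports Defs
begin

text \<open>
  Lagrangian sufficiency: on the feasible set the multiplier term
  \<open>2 \<bbbE>\<langle>F\<^sup>T\<lambda>, x(t)\<rangle> = 2 \<bbbE>\<langle>\<lambda>, F x(t)\<rangle>\<close> equals the constant \<open>2 \<bbbE>\<langle>\<lambda>, b\<rangle>\<close>,
  so there the two cost functionals differ by a constant.
\<close>

lemma space_aug_filtration: "space (aug_filtration M W s) = space M"
  by (simp add: aug_filtration_def space_measure_of_conv)

text \<open>Every generator already lies in \<open>sets M\<close>: preimages of Borel sets because
  each \<open>W r\<close> is measurable, and the added null sets because \<open>null_sets M\<close>
  contains measurable sets only.\<close>

lemma sets_aug_filtration_subset: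
  assumes "\<And>r. 0 \<le> r \<Longrightarrow> W r \<in> borel_measurable M"
  shows "sets (aug_filtration M W s) \<subseteq> sets M"
proof -
  let ?G = "{W r -` B \<inter> space M | r B. 0 \<le> r \<and> r \<le> s \<and> B \<in> sets borel} \<union> null_sets M"
  have G: "?G \<subseteq> sets M"
    using assms by (auto intro: measurable_sets)
  \<comment> \<open>Only for generators inside the power set of the space is \<open>sigma\<close>
    the generated sigma-algebra; otherwise it takes a trivial default value.\<close>
  then have "?G \<subseteq> Pow (space M)"
    using sets.space_closed by blast
  then have "sets (aug_filtration M W s) = sigma_sets (space M) ?G"
    unfolding aug_filtration_def by (rule sets_measure_of)
  with G show ?thesis
    by (simp add: sets.sigma_sets_subset)
qed

text \<open>Expectations are integrals over \<open>M\<close>, whereas members of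
  \<open>L2_rv\<close> are measurable for a smaller sigma-algebra; this passes from one to the
  other.\<close>

lemma L2_rv_borel_measurable:
  assumes "standard_brownian_motion M W" and "\<xi> \<in> L2_rv M W s"
  shows "\<xi> \<in> borel_measurable M"
proof (rule measurable_mono[THEN subsetD])
  show "\<xi> \<in> borel_measurable (aug_filtration M W s)"
    using assms(2) by (simp add: L2_rv_def)
  show "sets (aug_filtration M W s) \<subseteq> sets M"
    using assms(1) by (intro sets_aug_filtration_subset) (simp add: standard_brownian_motion_def)
qed (simp_all add: space_aug_filtration)

lemma cost_J_lam_feasible:
  fixes F :: "real ^ 'n ^ 'k"
  assumes "standard_brownian_motion M W"
    and "b \<in> L2_rv M W t" and "lam \<in> L2_rv M W t"
    and "fst (adapted_solution M W t T A K L \<eta> v) t \<in> constraint_set M W t F b"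
  shows "cost_J_lam M W t T A K L \<eta> G Q R N F lam v =
    cost_J M W t T A K L \<eta> G Q R N v + 2 * (LINT \<omega>|M. lam \<omega> \<bullet> b \<omega>)"
proof -
  obtain x z where xz: "adapted_solution M W t T A K L \<eta> v = (x, z)"
    by (cases "adapted_solution M W t T A K L \<eta> v")
  with assms(4) have x: "x t \<in> L2_rv M W t" and Fx: "AE \<omega> in M. F *v x t \<omega> = b \<omega>"
    by (simp_all add: constraint_set_def)
  note [measurable] = L2_rv_borel_measurable[OF assms(1) assms(2)]
    L2_rv_borel_measurable[OF assms(1) assms(3)] L2_rv_borel_measurable[OF assms(1) x]
  have [measurable]: "(*v) (transpose F) \<in> borel_measurable borel"
    by (intro borel_measurable_continuous_onI linear_continuous_on matrix_vector_mul_bounded_linear)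
  \<comment> \<open>The integrands agree almost everywhere, so measurability of both is enough and
    integrability need not be checked.\<close>
  have "(LINT \<omega>|M. (transpose F *v lam \<omega>) \<bullet> x t \<omega>) = (LINT \<omega>|M. lam \<omega> \<bullet> b \<omega>)"
  proof (rule integral_cong_AE)
    show "AE \<omega> in M. (transpose F *v lam \<omega>) \<bullet> x t \<omega> = lam \<omega> \<bullet> b \<omega>"
      \<comment> \<open>The transpose moves across the inner product as the adjoint, producing
        \<open>F *v x t \<omega>\<close>, which the constraint replaces by
        \<open>b \<omega>\<close>.\<close>
      using Fx by eventually_elim (metis dot_lmul_matrix transpose_matrix_vector)
  qed measurable
  with xz show ?thesis
    by (simp add: cost_J_lam_def)
qed

theorem proposition4p1:
  fixes M :: "'a measure" and W :: "real \<Rightarrow> 'a \<Rightarrow> real"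
    and t T \<delta> :: real and m :: nat
    and A K :: "real \<Rightarrow> real ^ 'n ^ 'n" and L :: "real \<Rightarrow> real ^ 'l ^ 'n"
    and G :: "real ^ 'n ^ 'n"
    and Q R :: "real \<Rightarrow> real ^ 'n ^ 'n" and N :: "real \<Rightarrow> real ^ 'l ^ 'l"
    and F :: "real ^ 'n ^ 'k" and b lam :: "'a \<Rightarrow> real ^ 'k"
    and \<eta> :: "'a \<Rightarrow> real ^ 'n"
    and vs :: "real \<Rightarrow> 'a \<Rightarrow> real ^ 'l"
    and xs zs :: "real \<Rightarrow> 'a \<Rightarrow> real ^ 'n"
  assumes "prob_space M" and "complete_measure M"
    and "standard_brownian_motion M W"
    and "0 \<le> t" and "t < T"
    and "CARD('n) < m" and "CARD('l) = m - CARD('n)"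
    and "A \<in> borel_measurable (lebesgue_on {0..T})" and "bounded (A ` {0..T})"
    and "K \<in> borel_measurable (lebesgue_on {0..T})" and "bounded (K ` {0..T})"
    and "L \<in> borel_measurable (lebesgue_on {0..T})" and "bounded (L ` {0..T})"
    and "Q \<in> borel_measurable (lebesgue_on {0..T})" and "bounded (Q ` {0..T})"
    and "R \<in> borel_measurable (lebesgue_on {0..T})" and "bounded (R ` {0..T})"
    and "N \<in> borel_measurable (lebesgue_on {0..T})" and "bounded (N ` {0..T})"
    and "transpose G = G"
    and "\<forall>s\<in>{0..T}. transpose (Q s) = Q s \<and> transpose (R s) = R s \<and> transpose (N s) = N s"
    and "\<delta> > 0"
    and "sym_psd G"
    and "AE s in lebesgue_on {0..T}. sym_psd (Q s) \<and> sym_psd (R s) \<and> sym_psd (N s - \<delta> *\<^sub>R mat 1)"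
    and "CARD('k) \<le> CARD('n)"
    and "b \<in> L2_rv M W t" and "lam \<in> L2_rv M W t"
    and "\<eta> \<in> L2_rv M W T"
    and "optimal_BLQ M W t T A K L \<eta> G Q R N F lam vs"
    and "(xs, zs) = adapted_solution M W t T A K L \<eta> vs"
    and "xs t \<in> constraint_set M W t F b"
  shows "optimal_CBLQ M W t T A K L \<eta> G Q R N F b vs"
proof -
  note BM = assms(3) and b = assms(26) and lam = assms(27)
    and opt = assms(29) and sol = assms(30) and feasible = assms(31)
  have vs: "fst (adapted_solution M W t T A K L \<eta> vs) t \<in> constraint_set M W t F b"
    using feasible by (simp flip: sol)
  have "cost_J M W t T A K L \<eta> G Q R N vs \<le> cost_J M W t T A K L \<eta> G Q R N v"
    if "v \<in> L2_prog M W t T"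
      and v: "fst (adapted_solution M W t T A K L \<eta> v) t \<in> constraint_set M W t F b" for v
  proof -
    have "cost_J_lam M W t T A K L \<eta> G Q R N F lam vs \<le> cost_J_lam M W t T A K L \<eta> G Q R N F lam v"
      using opt that by (simp add: optimal_BLQ_def)
    then show ?thesis
      \<comment> \<open>Both controls are feasible, so the same real number, independent of the
        control, is added on each side and cancels.\<close>
      by (simp add: cost_J_lam_feasible[OF BM b lam vs] cost_J_lam_feasible[OF BM b lam v])
  qed
  with opt vs show ?thesis
    by (simp add: optimal_CBLQ_def optimal_BLQ_def)
qed

end
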